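(* Let $n$ be a nonnegative integer and let $R$ be a commutative ring. Let $x_1,x_2,\ldots,x_n$ and $y_1,y_2,\ldots,y_n$ be elements of $R$ such that $x_i+y_j$ is invertible in $R$ for all $i,j\in\{1,2,\ldots,n\}$. Let $C$ be the $n\times n$-matrix over $R$ whose $(i,j)$-th entry is $\dfrac{1}{x_i+y_j}$ for all $i,j\in\{1,2,\ldots,n\}$. Assume that the matrix $C$ is invertible. Then the sum of all entries of its inverse $C^{-1}$ is $$\sum_{k=1}^{n}x_k+\sum_{k=1}^{n}y_k.$$
   Context: Here $\dfrac{1}{a}$ denotes the multiplicative inverse of an invertible element $a\in R$. *)

theory Defs
  imports "Jordan_Normal_Form.Matrix"
begin

text \<open>
  Commutative rings with unit are rendered by the sort \<open>{comm_ring, comm_monoid_mult}\<close>. The class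
  \<open>comm_ring_1\<close> additionally demands \<open>0 \<noteq> 1\<close> and so excludes the zero ring, which is an
  admissible base ring here. Invertibility of a ring element \<open>a\<close> is \<open>a dvd 1\<close>.
\<close>

text \<open>Meaningful only if \<open>a dvd 1\<close>.\<close>

definition unit_inv :: "'a::{comm_ring, comm_monoid_mult} \<Rightarrow> 'a" where
  "unit_inv a = (THE b. a * b = 1)"

lemma unit_inv_eqI:
  fixes a b :: "'a::{comm_ring, comm_monoid_mult}"
  assumes "a * b = 1"
  shows "unit_inv a = b"
  unfolding unit_inv_def
proof (rule the_equality)
  fix c assume "a * c = 1"
  then have "c = (a * b) * c" using assms by simp
  also have "\<dots> = (a * c) * b" by (simp only: ac_simps)
  finally show "c = b" using \<open>a * c = 1\<close> by simp
qed fact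

lemma mult_unit_inv:
  fixes a :: "'a::{comm_ring, comm_monoid_mult}"
  assumes "a dvd 1"
  shows "a * unit_inv a = 1"
  using assms unit_inv_eqI[of a] by (auto simp: dvd_def)

text \<open>
  The library's \<^const>\<open>inverts_mat\<close> and \<^const>\<open>invertible_mat\<close> are restricted to \<open>semiring_1\<close>,
  which again excludes the zero ring. The following are the same notions over the
  wider class of rings; \<open>inverse_mat A\<close> is meaningful only if \<open>A\<close> is invertible.
\<close>

definition is_inverse_mat :: "'a::{comm_ring, comm_monoid_mult} mat \<Rightarrow> 'a mat \<Rightarrow> bool" where
  "is_inverse_mat A B \<longleftrightarrow>
     square_mat A \<and> A * B = 1\<^sub>m (dim_row A) \<and> B * A = 1\<^sub>m (dim_row B)"

definition is_invertible_mat :: "'a::{comm_ring, comm_monoid_mult} mat \<Rightarrow> bool" where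
  "is_invertible_mat A \<longleftrightarrow> (\<exists>B. is_inverse_mat A B)"

definition inverse_mat :: "'a::{comm_ring, comm_monoid_mult} mat \<Rightarrow> 'a mat" where
  "inverse_mat A = (THE B. is_inverse_mat A B)"

lemma is_invertible_mat_iff_invertible_mat:
  fixes A :: "'a::comm_ring_1 mat"
  shows "is_invertible_mat A \<longleftrightarrow> invertible_mat A"
  unfolding is_invertible_mat_def is_inverse_mat_def invertible_mat_def inverts_mat_def by blast

lemma is_inverse_mat_carrier:
  assumes "is_inverse_mat A B"
  shows "A \<in> carrier_mat (dim_row A) (dim_row A)" "B \<in> carrier_mat (dim_row A) (dim_row A)"
proof -
  have sq: "dim_col A = dim_row A"
    and AB: "A * B = 1\<^sub>m (dim_row A)" and BA: "B * A = 1\<^sub>m (dim_row B)"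
    using assms by (auto simp: is_inverse_mat_def)
  from arg_cong[OF AB, of dim_col] arg_cong[OF BA, of dim_col] sq
  show "A \<in> carrier_mat (dim_row A) (dim_row A)" "B \<in> carrier_mat (dim_row A) (dim_row A)"
    by auto
qed

lemma one_mult_mat:
  fixes A :: "'a::{comm_ring, comm_monoid_mult} mat"
  assumes "A \<in> carrier_mat m n"
  shows "1\<^sub>m m * A = A" "A * 1\<^sub>m n = A"
  using assms
  by (auto intro!: eq_matI
      simp: scalar_prod_def if_distrib[where f = "\<lambda>t. t * _"] if_distrib[where f = "\<lambda>t. _ * t"]
      cong: if_cong)

lemma is_inverse_mat_unique:
  assumes "is_inverse_mat A B" "is_inverse_mat A B'"
  shows "B = B'"
proof -
  let ?n = "dim_row A"
  note c = is_inverse_mat_carrier[OF assms(1)] is_inverse_mat_carrier(2)[OF assms(2)]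
  have "B = B * (A * B')"
    using assms(2) one_mult_mat(2)[OF c(2)] by (simp add: is_inverse_mat_def)
  also have "\<dots> = (B * A) * B'"
    using assoc_mult_mat[OF c(2) c(1) c(3)] by simp
  also have "\<dots> = B'"
    using assms(1) one_mult_mat(1)[OF c(3)] c(2) by (simp add: is_inverse_mat_def)
  finally show ?thesis .
qed

lemma is_inverse_mat_inverse_mat:
  assumes "is_invertible_mat A"
  shows "is_inverse_mat A (inverse_mat A)"
  using assms unfolding is_invertible_mat_def inverse_mat_def
  by (metis is_inverse_mat_unique theI)

end

theory Submission
  imports Defs
begin

text \<open>
  Write \<open>1 = (x\<^sub>i + y\<^sub>j) C\<^sub>i\<^sub>j\<close> in front of every entry \<open>B\<^sub>j\<^sub>i\<close> of \<open>B = C\<inverse>\<close>: the sum of the entries of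
  \<open>B\<close> becomes \<open>\<Sum>\<^sub>i x\<^sub>i (C B)\<^sub>i\<^sub>i + \<Sum>\<^sub>j y\<^sub>j (B C)\<^sub>j\<^sub>j\<close>, in which all diagonal entries are \<open>1\<close>.
\<close>

text \<open>Serves both products: \<open>C * B\<close> for the terms in \<open>x\<close> and
  \<open>B * C\<close> for those in \<open>y\<close>.\<close>

lemma mult_mat_diag_eq_1:
  fixes A B :: "'a::{comm_ring, comm_monoid_mult} mat"
  assumes "A \<in> carrier_mat n m" "B \<in> carrier_mat m n" "A * B = 1\<^sub>m n" "i < n"
  shows "(\<Sum>j = 0..<m. A $$ (i, j) * B $$ (j, i)) = 1"
proof -
  have "(A * B) $$ (i, i) = 1"
    using assms(3,4) by simp
  then show ?thesis
    using assms(1,2,4) by (simp add: scalar_prod_def)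
qed

theorem theorem2p1:
  fixes n :: nat
    and x y :: "nat \<Rightarrow> 'a::{comm_ring, comm_monoid_mult}"
    and C :: "'a mat"
  assumes "\<And>i j. i \<in> {1..n} \<Longrightarrow> j \<in> {1..n} \<Longrightarrow> (x i + y j) dvd 1"
    and "C = mat n n (\<lambda>(i, j). unit_inv (x (Suc i) + y (Suc j)))"
    and "is_invertible_mat C"
  shows "sum_mat (inverse_mat C) = (\<Sum>k = 1..n. x k) + (\<Sum>k = 1..n. y k)"
proof -
  define B where "B = inverse_mat C"
  have inv: "is_inverse_mat C B"
    unfolding B_def by (rule is_inverse_mat_inverse_mat) fact
  have C: "C \<in> carrier_mat n n"
    using assms(2) by simp
  have B: "B \<in> carrier_mat n n"
    using is_inverse_mat_carrier(2)[OF inv] C by simp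
  have CB: "C * B = 1\<^sub>m n" and BC: "B * C = 1\<^sub>m n"
    using inv B C by (auto simp: is_inverse_mat_def)
  have entry: "B $$ (j, i) =
      x (Suc i) * (C $$ (i, j) * B $$ (j, i)) + y (Suc j) * (B $$ (j, i) * C $$ (i, j))"
    if "i < n" "j < n" for i j
  proof -
    \<comment> \<open>Matrix indices start at 0, those of \<open>x\<close> and \<open>y\<close> at
      1, hence \<open>Suc\<close>.\<close>
    have "(x (Suc i) + y (Suc j)) * C $$ (i, j) = 1"
      using that assms(1)[of "Suc i" "Suc j"] by (simp add: assms(2) mult_unit_inv)
    then have "B $$ (j, i) = ((x (Suc i) + y (Suc j)) * C $$ (i, j)) * B $$ (j, i)"
      by simp
    \<comment> \<open>Commutativity of the ring puts the second product in the order that occurs in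
      \<open>B * C\<close>.\<close>
    also have "\<dots> = x (Suc i) * (C $$ (i, j) * B $$ (j, i)) + y (Suc j) * (B $$ (j, i) * C $$ (i, j))"
      by (simp only: distrib_right distrib_left ac_simps)
    finally show ?thesis .
  qed
  have "sum_mat B = (\<Sum>j = 0..<n. \<Sum>i = 0..<n. B $$ (j, i))"
    using B by (simp add: sum_mat_def sum.cartesian_product)
  also have "\<dots> = (\<Sum>j = 0..<n. \<Sum>i = 0..<n.
      x (Suc i) * (C $$ (i, j) * B $$ (j, i)) + y (Suc j) * (B $$ (j, i) * C $$ (i, j)))"
    by (intro sum.cong refl entry) auto
  also have "\<dots> = (\<Sum>j = 0..<n. \<Sum>i = 0..<n. x (Suc i) * (C $$ (i, j) * B $$ (j, i)))
      + (\<Sum>j = 0..<n. \<Sum>i = 0..<n. y (Suc j) * (B $$ (j, i) * C $$ (i, j)))"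
    by (simp only: sum.distrib)
  \<comment> \<open>After the swap \<open>x (Suc i)\<close> is constant in the inner sum, which is
    the entry of \<open>C * B\<close> at \<open>(i, i)\<close>.\<close>
  also have "(\<Sum>j = 0..<n. \<Sum>i = 0..<n. x (Suc i) * (C $$ (i, j) * B $$ (j, i)))
      = (\<Sum>i = 0..<n. x (Suc i) * (\<Sum>j = 0..<n. C $$ (i, j) * B $$ (j, i)))"
    by (subst sum.swap) (simp only: sum_distrib_left)
  also have "\<dots> = (\<Sum>i = 0..<n. x (Suc i))"
    by (simp add: mult_mat_diag_eq_1[OF C B CB])
  \<comment> \<open>Here the inner sum over \<open>i\<close> already gives the entry of
    \<open>B * C\<close> at \<open>(j, j)\<close>.\<close>
  also have "(\<Sum>j = 0..<n. \<Sum>i = 0..<n. y (Suc j) * (B $$ (j, i) * C $$ (i, j)))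
      = (\<Sum>j = 0..<n. y (Suc j))"
    by (simp add: sum_distrib_left[symmetric] mult_mat_diag_eq_1[OF B C BC])
  finally show ?thesis
    unfolding B_def by (simp add: sum.atLeast1_atMost_eq atLeast0LessThan)
qed

end
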